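(* Assuming the Orthogonal Vectors Conjecture, there is no algorithm that, given a pattern $P\in\{0,1\}^{1\times p}$ (given as a length-$p$ array) and a 2D SLP $G$ representing a 2D text $T$ over the alphabet $\{0,1\}$, determines whether $P$ occurs in $T$ in $\mathcal{O}(|G|^{2-\epsilon}\cdot p^{\mathcal{O}(1)})$ time, for any constant $\epsilon>0$.
   Context: Orthogonal Vectors Conjecture: given any set $A\subseteq\{0,1\}^d$ of $|A|=n$ binary vectors with $d=\omega(\log n)$, it is not possible to determine whether there exist $x,y\in A$ with $x\cdot y=\sum_{i=1}^d x[i]y[i]=0$ in $\mathcal{O}(n^{2-\epsilon}\cdot d^{\mathcal{O}(1)})$ time, for any constant $\epsilon>0$. A 2D string over $\Sigma$ with $r$ rows and $c$ columns is a matrix in $\Sigma^{r\times c}$; $T[a..b)[c'..d)$ denotes the submatrix consisting of rows $a,\dots,b-1$ and columns $c',\dots,d-1$. $P\in\Sigma^{1\times p}$ occurs in $T\in\Sigma^{r\times c}$ if there exists $(i,j)\in[1..r]\times[1..c-p+1]$ with $T[i..i+1)[j..j+p)=P$. A 2D SLP is a tuple $G=(V_l,V_h,V_v,\Sigma,R,S)$ where $V_l$ (nonempty), $V_h$, $V_v$ are pairwise disjoint finite sets of literal, horizontal and vertical nonterminals, disjoint from the finite terminal alphabet $\Sigma$; $V=V_l\cup V_h\cup V_v$ and $S\in V$. Every $N\in V$ has exactly one rule $N\to\mathrm{rhs}(N)$: if $N\in V_l$ then $\mathrm{rhs}(N)\in\Sigma$; if $N\in V_h\cup V_v$ then $\mathrm{rhs}(N)=AB$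 with $A,B\in V$; there is an ordering $N_1,\dots,N_{|V|}$ of $V$ such that each right-hand side of $N_i\in V_h\cup V_v$ uses only $N_j$ with $j>i$. Expansions: for $N\in V_l$, $\mathrm{exp}(N)$ is the $1\times1$ matrix containing $\mathrm{rhs}(N)$; for $N\in V_h$ with $\mathrm{rhs}(N)=AB$ (expansions with equal numbers of columns), $\mathrm{exp}(N)$ is $\mathrm{exp}(A)$ on top of $\mathrm{exp}(B)$; for $N\in V_v$ with $\mathrm{rhs}(N)=AB$ (expansions with equal numbers of rows), $\mathrm{exp}(N)$ is $\mathrm{exp}(A)$ to the left of $\mathrm{exp}(B)$. $G$ represents $T=\mathrm{exp}(S)$. Size: $|G|=\sum_{N\in V}\max(|\mathrm{rhs}(N)|,1)$. *)

theory Defs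
  imports Complex_Main "HOL-Library.Landau_Symbols"
begin

section \<open>Word RAM\<close>

text \<open>
  Algorithms are programs of a word RAM with unit-cost instructions, a finite number of registers
  (those mentioned in the program) and a random access memory. Control flow is structured rather
  than by jumps, which changes running times by a constant factor only.
\<close>

datatype binop = Add | Sub | Mul | Div | Mod | And | Or | Xor | Shl | Shr

text \<open>Subtraction is truncated at 0, so it also serves for comparisons.\<close>

fun apply_op :: "binop \<Rightarrow> nat \<Rightarrow> nat \<Rightarrow> nat" where
  "apply_op Add a b = a + b"
| "apply_op Sub a b = a - b"
| "apply_op Mul a b = a * b"
| "apply_op Div a b = a div b"
| "apply_op Mod a b = a mod b"
| "apply_op And a b = Bit_Operations.and a b"
| "apply_op Or a b = Bit_Operations.or a b"
| "apply_op Xor a b = Bit_Operations.xor a b"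
| "apply_op Shl a b = push_bit b a"
| "apply_op Shr a b = drop_bit b a"

type_synonym reg = nat

text \<open>The tests \<open>IfNz\<close> and \<open>WhileNz\<close> are for a nonzero register; \<open>Load r a\<close> and \<open>Store a r\<close> take the
  address from register \<open>a\<close>.\<close>

datatype com =
    Skip
  | Const reg nat
  | Op binop reg reg reg
  | Load reg reg
  | Store reg reg
  | Seq com com
  | IfNz reg com com
  | WhileNz reg com

text \<open>Register contents and memory contents.\<close>

type_synonym state = "(reg \<Rightarrow> nat) \<times> (nat \<Rightarrow> nat)"

text \<open>
  \<open>exec w c s t s'\<close>: with words of \<open>w\<close> bits, program \<open>c\<close> started in \<open>s\<close> halts in \<open>s'\<close> after \<open>t\<close>
  steps. A program that overflows a word has no execution; wrap-around
  arithmetic is still available through \<open>Mod\<close>.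
\<close>

inductive exec :: "nat \<Rightarrow> com \<Rightarrow> state \<Rightarrow> nat \<Rightarrow> state \<Rightarrow> bool" for w :: nat where
  Skip: "exec w Skip s 1 s"
| Const: "v < 2 ^ w \<Longrightarrow> exec w (Const r v) (R, M) 1 (R(r := v), M)"
| Op: "apply_op f (R a) (R b) < 2 ^ w \<Longrightarrow>
    exec w (Op f r a b) (R, M) 1 (R(r := apply_op f (R a) (R b)), M)"
| Load: "M (R a) < 2 ^ w \<Longrightarrow> exec w (Load r a) (R, M) 1 (R(r := M (R a)), M)"
| Store: "exec w (Store a r) (R, M) 1 (R, M(R a := R r))"
| Seq: "exec w c1 s t1 s' \<Longrightarrow> exec w c2 s' t2 s'' \<Longrightarrow> exec w (Seq c1 c2) s (t1 + t2) s''"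
| IfTrue: "R r \<noteq> 0 \<Longrightarrow> exec w c1 (R, M) t s' \<Longrightarrow> exec w (IfNz r c1 c2) (R, M) (1 + t) s'"
| IfFalse: "R r = 0 \<Longrightarrow> exec w c2 (R, M) t s' \<Longrightarrow> exec w (IfNz r c1 c2) (R, M) (1 + t) s'"
| WhileFalse: "R r = 0 \<Longrightarrow> exec w (WhileNz r c) (R, M) 1 (R, M)"
| WhileTrue: "R r \<noteq> 0 \<Longrightarrow> exec w c (R, M) t1 s' \<Longrightarrow> exec w (WhileNz r c) s' t2 s'' \<Longrightarrow>
    exec w (WhileNz r c) (R, M) (1 + t1 + t2) s''"

definition init_state :: "nat list \<Rightarrow> state" where
  "init_state xs = (\<lambda>_. 0, \<lambda>i. if i < length xs then xs ! i else 0)"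

text \<open>Words have \<open>\<Theta>(log N)\<close> bits, where \<open>N\<close> is the length of the input; the constant factor \<open>k\<close>
  belongs to the algorithm.\<close>

definition word_size :: "nat \<Rightarrow> nat list \<Rightarrow> nat" where
  "word_size k xs = k * nat \<lceil>log 2 (real (length xs + 2))\<rceil>"

text \<open>Program \<open>c\<close> answers \<open>b\<close> (in register 0) on input \<open>xs\<close> within time \<open>T\<close>.\<close>

definition answers :: "com \<Rightarrow> nat \<Rightarrow> nat list \<Rightarrow> bool \<Rightarrow> real \<Rightarrow> bool" where
  "answers c k xs b T \<longleftrightarrow>
     (\<exists>t R M. exec (word_size k xs) c (init_state xs) t (R, M) \<and> real t \<le> T \<and> R 0 = of_bool b)"


section \<open>Orthogonal vectors\<close>

definition bin_vecs :: "nat \<Rightarrow> nat list set" where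
  "bin_vecs d = {x. length x = d \<and> set x \<subseteq> {0, 1}}"

definition dot :: "nat list \<Rightarrow> nat list \<Rightarrow> nat" where
  "dot x y = (\<Sum>i<length x. x ! i * y ! i)"

text \<open>A set of vectors is presented to an algorithm as an arbitrary enumeration of it.\<close>

definition ov_input :: "nat \<Rightarrow> nat list list \<Rightarrow> nat list" where
  "ov_input d xs = length xs # d # concat xs"

text \<open>
  \<open>c\<close> solves all instances with \<open>d = \<omega>(log n)\<close> in time \<open>O(n\<^bsup>2-\<epsilon>\<^esup> d\<^bsup>e\<^esup>)\<close>: the running time is
  \<open>O(n\<^bsup>2-\<epsilon>\<^esup> d(n)\<^bsup>e\<^esup>)\<close> for every dimension function \<open>d\<close> that grows faster than \<open>log n\<close>. A single
  program serves all \<open>d\<close>; for one fixed \<open>d\<close>, such as \<open>d(n) = n\<close>, the naive algorithm would do.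
\<close>

definition solves_OV :: "real \<Rightarrow> nat \<Rightarrow> com \<Rightarrow> nat \<Rightarrow> bool" where
  "solves_OV \<epsilon> e c k \<longleftrightarrow>
     (\<forall>d :: nat \<Rightarrow> nat. (\<forall>n. d n \<ge> 1) \<and> (\<lambda>n. real (d n)) \<in> \<omega>(\<lambda>n. ln (real n)) \<longrightarrow>
        (\<exists>K :: real. \<forall>A n xs. A \<subseteq> bin_vecs (d n) \<and> card A = n \<and> n \<ge> 1 \<and>
             distinct xs \<and> set xs = A \<longrightarrow>
           answers c k (ov_input (d n) xs) (\<exists>x\<in>A. \<exists>y\<in>A. dot x y = 0)
             (K * real n powr (2 - \<epsilon>) * real (d n) ^ e)))"

definition OV_conjecture :: bool where
  "OV_conjecture \<longleftrightarrow> (\<forall>\<epsilon>>0. \<not> (\<exists>e c k. solves_OV \<epsilon> e c k))"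


section \<open>2D strings\<close>

text \<open>A nonempty matrix is the list of its rows.\<close>

type_synonym 'a string2d = "'a list list"

definition nrows :: "'a string2d \<Rightarrow> nat" where
  "nrows T = length T"

definition ncols :: "'a string2d \<Rightarrow> nat" where
  "ncols T = length (hd T)"

text \<open>\<open>T[a..b)[c..d)\<close>, with rows and columns numbered from 1.\<close>

definition submatrix :: "'a string2d \<Rightarrow> nat \<Rightarrow> nat \<Rightarrow> nat \<Rightarrow> nat \<Rightarrow> 'a string2d" where
  "submatrix T a b c d = map (\<lambda>i. map (\<lambda>j. T ! (i - 1) ! (j - 1)) [c..<d]) [a..<b]"

text \<open>The pattern is a \<open>1 \<times> p\<close> matrix, given by its only row.\<close>

definition occurs :: "'a list \<Rightarrow> 'a string2d \<Rightarrow> bool" where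
  "occurs P T \<longleftrightarrow>
     (\<exists>i j. 1 \<le> i \<and> i \<le> nrows T \<and> 1 \<le> j \<and> j + length P \<le> ncols T + 1 \<and>
            submatrix T i (i + 1) j (j + length P) = [P])"


section \<open>2D straight-line programs\<close>

text \<open>Symbols on right-hand sides are \<open>Inl N\<close> for nonterminals and \<open>Inr a\<close> for terminals, which
  makes the two kinds of symbols disjoint.\<close>

record ('n, 'a) slp2d =
  Vl :: "'n set"
  Vh :: "'n set"
  Vv :: "'n set"
  alphabet :: "'a set"
  rhs :: "'n \<Rightarrow> ('n + 'a) list"
  start :: 'n

definition nonterminals :: "('n, 'a) slp2d \<Rightarrow> 'n set" where
  "nonterminals G = Vl G \<union> Vh G \<union> Vv G"

inductive expands :: "('n, 'a) slp2d \<Rightarrow> 'n \<Rightarrow> 'a string2d \<Rightarrow> bool" for G where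
  lit: "N \<in> Vl G \<Longrightarrow> rhs G N = [Inr a] \<Longrightarrow> expands G N [[a]]"
| hor: "N \<in> Vh G \<Longrightarrow> rhs G N = [Inl A, Inl B] \<Longrightarrow> expands G A X \<Longrightarrow> expands G B Y \<Longrightarrow>
    ncols X = ncols Y \<Longrightarrow> expands G N (X @ Y)"
| ver: "N \<in> Vv G \<Longrightarrow> rhs G N = [Inl A, Inl B] \<Longrightarrow> expands G A X \<Longrightarrow> expands G B Y \<Longrightarrow>
    nrows X = nrows Y \<Longrightarrow> expands G N (map2 (@) X Y)"

text \<open>The last condition says that the dimensions match in every rule.\<close>

definition wf_slp2d :: "('n, 'a) slp2d \<Rightarrow> bool" where
  "wf_slp2d G \<longleftrightarrow>
     finite (nonterminals G) \<and> finite (alphabet G) \<and> Vl G \<noteq> {} \<and>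
     Vl G \<inter> Vh G = {} \<and> Vl G \<inter> Vv G = {} \<and> Vh G \<inter> Vv G = {} \<and>
     start G \<in> nonterminals G \<and>
     (\<forall>N\<in>Vl G. \<exists>a\<in>alphabet G. rhs G N = [Inr a]) \<and>
     (\<forall>N\<in>Vh G \<union> Vv G. \<exists>A\<in>nonterminals G. \<exists>B\<in>nonterminals G. rhs G N = [Inl A, Inl B]) \<and>
     (\<exists>Ns. distinct Ns \<and> set Ns = nonterminals G \<and>
        (\<forall>i<length Ns. Ns ! i \<in> Vh G \<union> Vv G \<longrightarrow>
           (\<forall>A. Inl A \<in> set (rhs G (Ns ! i)) \<longrightarrow> (\<exists>j<length Ns. i < j \<and> Ns ! j = A)))) \<and>
     (\<forall>N\<in>nonterminals G. \<exists>X. expands G N X)"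

definition represents :: "('n, 'a) slp2d \<Rightarrow> 'a string2d \<Rightarrow> bool" where
  "represents G T \<longleftrightarrow> expands G (start G) T"

definition slp_size :: "('n, 'a) slp2d \<Rightarrow> nat" where
  "slp_size G = (\<Sum>N\<in>nonterminals G. max (length (rhs G N)) 1)"


section \<open>Pattern matching on 2D straight-line programs\<close>

text \<open>
  For the machine, the nonterminals are numbered \<open>0, \<dots>, |V| - 1\<close> in arbitrary order. Each rule
  takes three words: the kind of the nonterminal and the right-hand side, padded by 0 for literals.
\<close>

definition rule_code :: "(nat, nat) slp2d \<Rightarrow> nat \<Rightarrow> nat list" where
  "rule_code G N =
     (if N \<in> Vl G then 0 else if N \<in> Vh G then 1 else 2) #
     map (case_sum id id) (rhs G N) @ (if N \<in> Vl G then [0] else [])"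

definition matching_input :: "nat list \<Rightarrow> (nat, nat) slp2d \<Rightarrow> nat list" where
  "matching_input P G =
     length P # P @
     card (nonterminals G) # start G # concat (map (rule_code G) [0..<card (nonterminals G)])"

definition solves_matching :: "real \<Rightarrow> nat \<Rightarrow> com \<Rightarrow> nat \<Rightarrow> bool" where
  "solves_matching \<epsilon> e c k \<longleftrightarrow>
     (\<exists>K :: real. \<forall>P G T.
        P \<noteq> [] \<and> set P \<subseteq> {0, 1} \<and>
        wf_slp2d G \<and> alphabet G = {0, 1} \<and> nonterminals G = {0..<card (nonterminals G)} \<and>
        represents G T \<longrightarrow>
          answers c k (matching_input P G) (occurs P T)
            (K * real (slp_size G) powr (2 - \<epsilon>) * real (length P) ^ e))"

end

theory Submission imports Defs begin

text \<open>
  Extend every vector \<open>x\<close> of the instance to \<open>x' = x @ [0, 1]\<close>, of length \<open>D = d + 2\<close>. The text has, for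
  every \<open>x\<close>, the row consisting of a \<open>1\<close> and of the blocks of entrywise products of \<open>x'\<close> and \<open>y'\<close>, for
  all \<open>y\<close> in turn; every block ends in \<open>0 1\<close>, hence \<open>0\<^bsup>d+1\<^esup>\<close> occurs in the row iff some block is
  \<open>0\<^bsup>d+1\<^esup> 1\<close>, that is, iff some \<open>y\<close> is orthogonal to \<open>x\<close>. The grammar first builds, row by row, the
  \<open>D\<close> columns of the matrix of all \<open>x'\<close>, and then appends columns: column \<open>s\<close> of a block is column \<open>s\<close>
  of that matrix if \<open>y' ! s = 1\<close>, and its zero column \<open>d\<close> otherwise. An additional top row of ones lets
  every column start from a literal; it contains no occurrence of the pattern. The grammar thus has
  size \<open>O(n d)\<close>.

  The encoding of the grammar is longer than that of the instance, and each of its cells depends only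
  on \<open>n\<close>, \<open>d\<close> and on a cell of the instance at a smaller address. A word RAM can therefore
  overwrite the instance by the grammar in place, at descending addresses, in time \<open>O(n d)\<close>; then it
  runs the matching algorithm.
\<close>

section \<open>Word RAM programs\<close>

text \<open>The word size occurs in the rules only as an upper bound on values. Overflow blocks
  execution instead of wrapping around, so longer words preserve every run.\<close>

lemma exec_mono_word:
  assumes "exec w c s t s'" "w \<le> w'"
  shows "exec w' c s t s'"
proof -
  have le: "(2::nat) ^ w \<le> 2 ^ w'"
    using assms(2) by simp
  show ?thesis
    using assms(1)
    by (induction rule: exec.induct)
      (blast intro: exec.intros order.strict_trans2[OF _ le])+
qed

text \<open>Time is an upper bound here, so that costs can be rounded up and branches need not be
  balanced.\<close>

definition runs :: "nat \<Rightarrow> com \<Rightarrow> state \<Rightarrow> nat \<Rightarrow> state \<Rightarrow> bool" where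
  "runs w c s T s' \<longleftrightarrow> (\<exists>t\<le>T. exec w c s t s')"

lemma runs_exec: "exec w c s t s' \<Longrightarrow> t \<le> T \<Longrightarrow> runs w c s T s'"
  by (auto simp: runs_def)

lemma runs_Const: "v < 2 ^ w \<Longrightarrow> runs w (Const r v) (R, M) (Suc 0) (R(r := v), M)"
  using exec.Const[of v w r R M] by (simp add: runs_exec)

lemma runs_Op:
  "apply_op f (R a) (R b) < 2 ^ w \<Longrightarrow>
    runs w (Op f r a b) (R, M) (Suc 0) (R(r := apply_op f (R a) (R b)), M)"
  using exec.Op[of f R a b w r M] by (simp add: runs_exec)

lemma runs_Load:
  "M (R a) < 2 ^ w \<Longrightarrow> runs w (Load r a) (R, M) (Suc 0) (R(r := M (R a)), M)"
  using exec.Load[of M R a w r] by (simp add: runs_exec)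

lemma runs_Store: "runs w (Store a r) (R, M) (Suc 0) (R, M(R a := R r))"
  using exec.Store[of w a r R M] by (simp add: runs_exec)

lemma runs_Seq:
  "runs w c1 s T1 s' \<Longrightarrow> runs w c2 s' T2 s'' \<Longrightarrow> T1 + T2 \<le> T \<Longrightarrow> runs w (Seq c1 c2) s T s''"
  unfolding runs_def by (meson add_mono exec.Seq order.trans)

lemma runs_IfNz:
  assumes "runs w (if R r \<noteq> 0 then c1 else c2) (R, M) T s'" "Suc T \<le> T'"
  shows "runs w (IfNz r c1 c2) (R, M) T' s'"
proof -
  obtain t where t: "t \<le> T" "exec w (if R r \<noteq> 0 then c1 else c2) (R, M) t s'"
    using assms(1) by (auto simp: runs_def)
  have "exec w (IfNz r c1 c2) (R, M) (1 + t) s'"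
    using t(2) exec.IfTrue[of R r w c1 M t s' c2] exec.IfFalse[of R r w c2 M t s' c1]
    by (cases "R r = 0") simp_all
  then show ?thesis
    using t(1) assms(2) by (intro runs_exec[where t = "1 + t"]) auto
qed

lemma runs_WhileNz_step:
  assumes "R r \<noteq> 0" "runs w c (R, M) T1 s'" "runs w (WhileNz r c) s' T2 s''"
    and "1 + T1 + T2 \<le> T"
  shows "runs w (WhileNz r c) (R, M) T s''"
proof -
  obtain t1 t2 where "t1 \<le> T1" "exec w c (R, M) t1 s'" "t2 \<le> T2" "exec w (WhileNz r c) s' t2 s''"
    using assms(2,3) by (auto simp: runs_def)
  then show ?thesis
    using assms(1,4) exec.WhileTrue[of R r w c M t1 s' t2 s'']
    by (intro runs_exec[where t = "1 + t1 + t2"]) auto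
qed

fun clear :: "nat \<Rightarrow> com" where
  "clear 0 = Skip"
| "clear (Suc m) = Seq (clear m) (Const m 0)"

lemma runs_clear: "runs w (clear m) (R, M) (Suc m) (\<lambda>i. if i < m then 0 else R i, M)"
proof (induction m)
  case 0
  show ?case using exec.Skip[of w "(R, M)"] by (simp add: runs_exec)
next
  case (Suc m)
  let ?R = "\<lambda>i. if i < m then 0 else R i"
  have "runs w (Const m 0) (?R, M) (Suc 0) (?R(m := 0), M)"
    by (intro runs_Const) auto
  moreover have "?R(m := 0) = (\<lambda>i. if i < Suc m then 0 else R i)"
    by (auto simp: fun_eq_iff)
  ultimately show ?case
    using Suc by (auto intro: runs_Seq)
qed

section \<open>Arithmetic expressions and their compilation\<close>

datatype expr = Lit nat | Var reg | Bin binop expr expr | Ld expr | Cond expr expr expr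

fun val :: "state \<Rightarrow> expr \<Rightarrow> nat" where
  "val s (Lit v) = v"
| "val s (Var x) = fst s x"
| "val s (Bin f e1 e2) = apply_op f (val s e1) (val s e2)"
| "val s (Ld e) = snd s (val s e)"
| "val s (Cond e e1 e2) = (if val s e \<noteq> 0 then val s e1 else val s e2)"

fun fits :: "nat \<Rightarrow> state \<Rightarrow> expr \<Rightarrow> bool" where
  "fits w s (Lit v) \<longleftrightarrow> v < 2 ^ w"
| "fits w s (Var x) \<longleftrightarrow> fst s x < 2 ^ w"
| "fits w s (Bin f e1 e2) \<longleftrightarrow>
     fits w s e1 \<and> fits w s e2 \<and> apply_op f (val s e1) (val s e2) < 2 ^ w"
| "fits w s (Ld e) \<longleftrightarrow> fits w s e \<and> snd s (val s e) < 2 ^ w"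
| "fits w s (Cond e e1 e2) \<longleftrightarrow>
     fits w s e \<and> (if val s e \<noteq> 0 then fits w s e1 else fits w s e2)"

fun vars :: "expr \<Rightarrow> reg set" where
  "vars (Lit v) = {}"
| "vars (Var x) = {x}"
| "vars (Bin f e1 e2) = vars e1 \<union> vars e2"
| "vars (Ld e) = vars e"
| "vars (Cond e e1 e2) = vars e \<union> vars e1 \<union> vars e2"

text \<open>The result goes to register \<open>r\<close>; the registers from \<open>r\<close> on serve as an evaluation stack.\<close>

fun compile :: "expr \<Rightarrow> reg \<Rightarrow> com" where
  "compile (Lit v) r = Const r v"
| "compile (Var x) r = Op Or r x x"
| "compile (Bin f e1 e2) r =
     Seq (compile e1 r) (Seq (compile e2 (Suc r)) (Op f r r (Suc r)))"
| "compile (Ld e) r = Seq (compile e r) (Load r r)"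
| "compile (Cond e e1 e2) r = Seq (compile e r) (IfNz r (compile e1 r) (compile e2 r))"

fun cost :: "expr \<Rightarrow> nat" where
  "cost (Lit v) = 1"
| "cost (Var x) = 1"
| "cost (Bin f e1 e2) = cost e1 + cost e2 + 1"
| "cost (Ld e) = cost e + 1"
| "cost (Cond e e1 e2) = cost e + cost e1 + cost e2 + 1"

lemma val_cong: "(\<And>x. x \<in> vars e \<Longrightarrow> R x = R' x) \<Longrightarrow> val (R, M) e = val (R', M) e"
  by (induction e) auto

lemma fits_cong: "(\<And>x. x \<in> vars e \<Longrightarrow> R x = R' x) \<Longrightarrow> fits w (R, M) e = fits w (R', M) e"
proof (induction e)
  case (Bin f e1 e2)
  then show ?case
    using val_cong[of e1 R R' M] val_cong[of e2 R R' M] by auto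
next
  case (Ld e)
  then show ?case
    using val_cong[of e R R' M] by auto
next
  case (Cond e e1 e2)
  then show ?case
    using val_cong[of e R R' M] by auto
qed auto

text \<open>The cost also bounds the height of the evaluation stack, hence delimits the registers
  that are overwritten. Variables lie below \<open>r\<close> and so keep their values while
  subexpressions are evaluated.\<close>

lemma runs_compile:
  assumes "fits w (R, M) e" "vars e \<subseteq> {..<r}"
  shows "\<exists>R'. runs w (compile e r) (R, M) (cost e) (R', M) \<and> R' r = val (R, M) e \<and>
           (\<forall>x. x < r \<or> r + cost e \<le> x \<longrightarrow> R' x = R x)"
  using assms
proof (induction e arbitrary: R r)
  case (Lit v)
  then show ?case
    by (intro exI[of _ "R(r := v)"]) (auto intro: runs_Const[unfolded fun_upd_def] simp: fun_upd_def)
next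
  case (Var x)
  \<comment> \<open>Bitwise or of a register with itself is a copy, and its result fits because
    \<open>R x\<close> does.\<close>
  then have "runs w (Op Or r x x) (R, M) (Suc 0) (R(r := apply_op Or (R x) (R x)), M)"
    by (intro runs_Op) simp
  then show ?case
    by (intro exI[of _ "R(r := R x)"]) (simp del: fun_upd_apply, simp)
next
  case (Bin f e1 e2)
  obtain R1 where R1: "runs w (compile e1 r) (R, M) (cost e1) (R1, M)" "R1 r = val (R, M) e1"
    "\<And>x. x < r \<or> r + cost e1 \<le> x \<Longrightarrow> R1 x = R x"
    using Bin.IH(1)[of R r] Bin.prems by auto
  have same: "\<And>x. x \<in> vars e2 \<Longrightarrow> R1 x = R x"
    using Bin.prems(2) by (intro R1(3)) auto
  have eq: "fits w (R1, M) e2 = fits w (R, M) e2" "val (R1, M) e2 = val (R, M) e2"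
    using fits_cong[OF same] val_cong[OF same] by auto
  obtain R2 where R2: "runs w (compile e2 (Suc r)) (R1, M) (cost e2) (R2, M)"
    "R2 (Suc r) = val (R, M) e2" "\<And>x. x < Suc r \<or> Suc r + cost e2 \<le> x \<Longrightarrow> R2 x = R1 x"
    using Bin.IH(2)[of R1 "Suc r"] Bin.prems eq by force
  let ?v = "apply_op f (R2 r) (R2 (Suc r))"
  have v: "?v = val (R, M) (Bin f e1 e2)"
    using R1(2) R2(2,3) by simp
  have "runs w (Op f r r (Suc r)) (R2, M) (Suc 0) (R2(r := ?v), M)"
    using Bin.prems v by (intro runs_Op) auto
  then have "runs w (compile (Bin f e1 e2) r) (R, M) (cost (Bin f e1 e2)) (R2(r := ?v), M)"
    using R1(1) R2(1) by (auto intro!: runs_Seq)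
  moreover have "(R2(r := ?v)) x = R x" if "x < r \<or> r + cost (Bin f e1 e2) \<le> x" for x
  proof -
    have "cost e1 \<ge> 1" by (cases e1) auto
    then have "x \<noteq> r" "R2 x = R1 x" "R1 x = R x"
      using that by (auto intro!: R2(3) R1(3))
    then show ?thesis by simp
  qed
  moreover have "(R2(r := ?v)) r = val (R, M) (Bin f e1 e2)"
    using v by simp
  ultimately show ?case by blast
next
  case (Ld e)
  obtain R1 where R1: "runs w (compile e r) (R, M) (cost e) (R1, M)" "R1 r = val (R, M) e"
    "\<And>x. x < r \<or> r + cost e \<le> x \<Longrightarrow> R1 x = R x"
    using Ld.IH[of R r] Ld.prems by auto
  have "runs w (Load r r) (R1, M) (Suc 0) (R1(r := M (R1 r)), M)"
    using Ld.prems R1(2) by (intro runs_Load) auto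
  then have "runs w (compile (Ld e) r) (R, M) (cost (Ld e)) (R1(r := M (R1 r)), M)"
    using R1(1) by (auto intro!: runs_Seq)
  moreover have "(R1(r := M (R1 r))) r = val (R, M) (Ld e)"
    using R1(2) by simp
  moreover have "(R1(r := M (R1 r))) x = R x" if "x < r \<or> r + cost (Ld e) \<le> x" for x
    using that R1(3)[of x] by auto
  ultimately show ?case by blast
next
  case (Cond e e1 e2)
  obtain R1 where R1: "runs w (compile e r) (R, M) (cost e) (R1, M)" "R1 r = val (R, M) e"
    "\<And>x. x < r \<or> r + cost e \<le> x \<Longrightarrow> R1 x = R x"
    using Cond.IH(1)[of R r] Cond.prems by (metis Un_subset_iff fits.simps(5) vars.simps(5))
  define e' where "e' = (if R1 r \<noteq> 0 then e1 else e2)"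
  have e': "fits w (R, M) e'" "vars e' \<subseteq> {..<r}" "cost e' \<le> cost e1 + cost e2"
    "val (R, M) (Cond e e1 e2) = val (R, M) e'"
    using Cond.prems R1(2) by (auto simp: e'_def)
  have same: "\<And>x. x \<in> vars e' \<Longrightarrow> R1 x = R x"
    using e'(2) by (intro R1(3)) auto
  have eq: "fits w (R1, M) e' = fits w (R, M) e'" "val (R1, M) e' = val (R, M) e'"
    using fits_cong[OF same] val_cong[OF same] by auto
  have "\<exists>R'. runs w (compile e' r) (R1, M) (cost e') (R', M) \<and> R' r = val (R1, M) e' \<and>
           (\<forall>x. x < r \<or> r + cost e' \<le> x \<longrightarrow> R' x = R1 x)"
    using Cond.IH(2,3)[of R1 r] e' eq by (auto simp: e'_def)
  then obtain R2 where R2: "runs w (compile e' r) (R1, M) (cost e') (R2, M)"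
    "R2 r = val (R, M) e'" "\<And>x. x < r \<or> r + cost e' \<le> x \<Longrightarrow> R2 x = R1 x"
    using eq by auto
  have "runs w (IfNz r (compile e1 r) (compile e2 r)) (R1, M) (Suc (cost e')) (R2, M)"
    using R2(1) by (intro runs_IfNz[where T = "cost e'"]) (auto simp: e'_def)
  then have "runs w (compile (Cond e e1 e2) r) (R, M) (cost (Cond e e1 e2)) (R2, M)"
    using R1(1) e'(3) by (auto intro!: runs_Seq)
  then show ?case
    using R2(2,3) R1(3) e'(3,4) by (intro exI[of _ R2]) auto
qed

text \<open>A cube triples the logarithm. The part \<open>3 * k\<close> of the factor covers the
  words of a program run on \<open>ys\<close>; the summand 3 makes addresses in \<open>ys\<close>
  fit even for \<open>k = 0\<close>.\<close>

lemma word_size_cubic: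
  assumes "length ys + 2 \<le> (length xs + 2) ^ 3"
  shows "word_size k ys \<le> word_size (3 * k + 3) xs" "length ys < 2 ^ word_size (3 * k + 3) xs"
proof -
  define b where "b = nat \<lceil>log 2 (real (length xs + 2))\<rceil>"
  have "log 2 (real (length xs + 2)) \<le> real b"
    unfolding b_def by linarith
  then have "real (length xs + 2) \<le> 2 powr real b"
    by (subst (asm) log_le_iff) auto
  then have "real (length xs + 2) \<le> real (2 ^ b)"
    by (simp add: powr_realpow)
  then have "length xs + 2 \<le> 2 ^ b"
    by (simp only: of_nat_le_iff)
  then have "(length xs + 2) ^ 3 \<le> (2 ^ b) ^ 3"
    by (intro power_mono) auto
  then have ys: "length ys + 2 \<le> 2 ^ (3 * b)"
    using assms by (simp add: power_mult[symmetric] mult.commute)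
  then have "real (length ys + 2) \<le> real (2 ^ (3 * b))"
    by (simp only: of_nat_le_iff)
  then have "real (length ys + 2) \<le> 2 powr real (3 * b)"
    using powr_realpow[of 2 "3 * b"] by simp
  then have "log 2 (real (length ys + 2)) \<le> real (3 * b)"
    by (subst log_le_iff) auto
  then have "nat \<lceil>log 2 (real (length ys + 2))\<rceil> \<le> 3 * b"
    by linarith
  then have "k * nat \<lceil>log 2 (real (length ys + 2))\<rceil> \<le> k * (3 * b)"
    by (rule mult_le_mono2)
  moreover have "(3 * k + 3) * b = k * (3 * b) + 3 * b"
    by (simp add: algebra_simps)
  ultimately show "word_size k ys \<le> word_size (3 * k + 3) xs"
    unfolding word_size_def b_def[symmetric] by linarith
  have "(2::nat) ^ (3 * b) \<le> 2 ^ word_size (3 * k + 3) xs"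
    unfolding word_size_def b_def[symmetric] by (intro power_increasing mult_le_mono1) auto
  then show "length ys < 2 ^ word_size (3 * k + 3) xs"
    using ys by linarith
qed

text \<open>Replaces the exact cost by numerals \<open>T\<close> and \<open>b\<close>, which keeps
  the bounds for composite programs simple.\<close>

lemma runs_compile_below:
  assumes "fits w (R, M) e" "val (R, M) e = v" "vars e \<subseteq> {..<r}" "cost e \<le> T" "r + T \<le> b"
  shows "\<exists>R'. runs w (compile e r) (R, M) T (R', M) \<and> R' r = v \<and>
           (\<forall>x. x < r \<or> b \<le> x \<longrightarrow> R' x = R x)"
proof -
  obtain R' where R': "runs w (compile e r) (R, M) (cost e) (R', M)" "R' r = v"
    "\<And>x. x < r \<or> r + cost e \<le> x \<Longrightarrow> R' x = R x"
    using runs_compile[OF assms(1,3)] assms(2) by auto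
  have "runs w (compile e r) (R, M) T (R', M)"
    using R'(1) assms(4) by (auto simp: runs_def intro: order.trans)
  moreover have "R' x = R x" if "x < r \<or> b \<le> x" for x
    using that assms(4,5) by (intro R'(3)) auto
  ultimately show ?thesis
    using R'(2) by blast
qed

section \<open>The reduction from orthogonal vectors\<close>

lemma nth_concat_uniform:
  assumes "\<And>x. x \<in> set xs \<Longrightarrow> length x = m" "i < length xs" "r < m"
  shows "concat xs ! (i * m + r) = xs ! i ! r"
  using assms
proof (induction xs arbitrary: i)
  case (Cons x xs)
  then show ?case
    by (cases i) (auto simp: nth_append add.assoc)
qed simp

lemma length_concat_uniform:
  "(\<And>x. x \<in> set xs \<Longrightarrow> length x = m) \<Longrightarrow> length (concat xs) = length xs * m"
  by (induction xs) auto

text \<open>\<open>submatrix\<close> numbers rows and columns from 1; shifting both coordinates by 1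
  turns them into list indices.\<close>

lemma occurs_iff:
  "occurs P T \<longleftrightarrow> (\<exists>i<nrows T. \<exists>j. j + length P \<le> ncols T \<and> (\<forall>t<length P. T ! i ! (j + t) = P ! t))"
proof
  assume "occurs P T"
  then obtain i j where ij: "1 \<le> i" "i \<le> nrows T" "1 \<le> j" "j + length P \<le> ncols T + 1"
    and eq: "map (\<lambda>j. T ! (i - 1) ! (j - 1)) [j..<j + length P] = P"
    by (auto simp: occurs_def submatrix_def)
  have "T ! (i - 1) ! (j - 1 + t) = P ! t" if "t < length P" for t
    using arg_cong[OF eq, of "\<lambda>xs. xs ! t"] that ij(3) by simp
  with ij show "\<exists>i<nrows T. \<exists>j. j + length P \<le> ncols T \<and> (\<forall>t<length P. T ! i ! (j + t) = P ! t)"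
    by (intro exI[of _ "i - 1"] conjI exI[of _ "j - 1"]) auto
next
  assume "\<exists>i<nrows T. \<exists>j. j + length P \<le> ncols T \<and> (\<forall>t<length P. T ! i ! (j + t) = P ! t)"
  then obtain i j where "i < nrows T" "j + length P \<le> ncols T"
    and "\<And>t. t < length P \<Longrightarrow> T ! i ! (j + t) = P ! t"
    by auto
  moreover from this have "map (\<lambda>j. T ! i ! (j - 1)) [Suc j..<Suc j + length P] = P"
    by (intro nth_equalityI) (auto simp del: upt_Suc)
  ultimately show "occurs P T"
    unfolding occurs_def by (intro exI[of _ "Suc i"] exI[of _ "Suc j"]) (auto simp: submatrix_def)
qed

section \<open>Extended vectors and the program that rewrites the instance\<close>

definition ext :: "nat list \<Rightarrow> nat list" where
  "ext x = x @ [0, 1]"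

text \<open>In the loop, registers 0 to 7 hold \<open>d\<close>, \<open>D = d + 2\<close>, \<open>A = n D\<close>, the loop counter, the address of
  the cell to be rewritten, the number of the rule that the cell belongs to, its position within that
  rule, and the index into the concatenation of the extended vectors. \<open>Cond\<close> evaluates only the
  branch taken, so that no intermediate value overflows a word.\<close>

definition index_expr :: expr where
  "index_expr = Bin Mod (Var 7) (Var 1)"

text \<open>Truncated subtraction serves as comparison: the test is nonzero iff the coordinate
  \<open>s\<close> is below \<open>d\<close>. Coordinate \<open>s\<close> of vector \<open>j\<close>
  is stored at \<open>2 + j * d + s\<close>, behind the words for \<open>n\<close> and
  \<open>d\<close>; the appended coordinates 0 and 1 equal \<open>s - d\<close>.\<close>

definition entry_expr :: expr where
  "entry_expr =
     Cond (Bin Sub (Var 0) index_expr)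
       (Ld (Bin Add (Bin Add (Lit 2) (Bin Mul (Bin Div (Var 7) (Var 1)) (Var 0))) index_expr))
       (Bin Sub index_expr (Var 0))"

definition col_expr :: expr where
  "col_expr = Cond entry_expr index_expr (Var 0)"

text \<open>This is the number of nonterminals, called \<open>V\<close> below.\<close>

definition size_expr :: expr where
  "size_expr = Bin Add (Bin Add (Lit 1) (Var 1)) (Bin Mul (Lit 2) (Var 2))"

text \<open>Addresses \<open>0\<close> to \<open>d + 3\<close> of the target: pattern length,
  \<open>d + 1\<close> zeros, number of nonterminals, start symbol.\<close>

definition header_expr :: expr where
  "header_expr =
     Cond (Var 4)
       (Cond (Bin Sub (Var 4) (Bin Add (Var 0) (Lit 1)))
          (Cond (Bin Sub (Var 4) (Bin Add (Var 0) (Lit 2)))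
             (Bin Sub size_expr (Lit 1))
             size_expr)
          (Lit 0))
       (Bin Add (Var 0) (Lit 1))"

text \<open>Kind 0, terminal, padding 0; literal 0 has terminal 0 and all others have terminal
  1.\<close>

definition literal_expr :: expr where
  "literal_expr =
     Cond (Bin Sub (Var 6) (Lit 1)) (Lit 0) (Cond (Var 6) (Cond (Var 5) (Lit 1) (Lit 0)) (Lit 0))"

definition column_expr :: expr where
  "column_expr =
     Cond (Var 6)
       (Cond (Bin Sub (Var 6) (Lit 1)) entry_expr (Bin Sub (Var 5) (Var 1)))
       (Lit 1)"

definition block_expr :: expr where
  "block_expr =
     Cond (Var 6)
       (Cond (Bin Sub (Var 6) (Lit 1))
          (Bin Add (Bin Add (Lit 1) (Var 2)) col_expr)
          (Bin Sub (Var 5) (Lit 1)))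
       (Lit 2)"

definition cell_expr :: expr where
  "cell_expr =
     Cond (Bin Sub (Var 4) (Bin Add (Var 0) (Lit 3)))
       (Cond (Bin Sub (Var 5) (Var 1))
          (Cond (Bin Sub (Bin Add (Bin Add (Lit 1) (Var 1)) (Var 2)) (Var 5))
             column_expr
             block_expr)
          literal_expr)
       header_expr"

definition address_expr :: expr where
  "address_expr = Bin Sub (Var 3) (Lit 1)"

definition offset_expr :: expr where
  "offset_expr = Bin Sub (Var 4) (Bin Add (Var 0) (Lit 4))"

definition rule_expr :: expr where
  "rule_expr = Bin Div offset_expr (Lit 3)"

definition position_expr :: expr where
  "position_expr = Bin Mod offset_expr (Lit 3)"

text \<open>Column rules start at \<open>1 + D\<close> and block rules at \<open>1 + D + A\<close>,
  so reduction modulo \<open>A\<close> gives the index for both.\<close>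

definition vector_expr :: expr where
  "vector_expr = Bin Mod (Bin Sub (Var 5) (Bin Add (Lit 1) (Var 1))) (Var 2)"

text \<open>The stack of \<open>cell_expr\<close> starts above the eight named registers. The final
  copy of the address into register 3 decrements the counter.\<close>

definition rewrite_cell :: com where
  "rewrite_cell =
     Seq (compile address_expr 4)
    (Seq (compile rule_expr 5)
    (Seq (compile position_expr 6)
    (Seq (compile vector_expr 7)
    (Seq (compile cell_expr 8)
    (Seq (Store 4 8)
         (Op Or 3 4 4))))))"

definition dim_expr :: expr where
  "dim_expr = Ld (Lit 1)"

definition ext_dim_expr :: expr where
  "ext_dim_expr = Bin Add (Var 0) (Lit 2)"

definition total_expr :: expr where
  "total_expr = Bin Mul (Ld (Lit 0)) (Var 1)"

definition counter_expr :: expr where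
  "counter_expr = Bin Add (Bin Add (Var 0) (Lit 4)) (Bin Mul (Lit 3) size_expr)"

text \<open>\<open>c\<close> must start with all registers 0; the steps before
  \<open>clear 200\<close> change no register from 200 on.\<close>

definition reduction :: "com \<Rightarrow> com" where
  "reduction c =
     Seq (compile dim_expr 0)
    (Seq (compile ext_dim_expr 1)
    (Seq (compile total_expr 2)
    (Seq (compile counter_expr 3)
    (Seq (WhileNz 3 rewrite_cell)
    (Seq (clear 200)
         c)))))"

lemma vars_cell_expr: "vars cell_expr \<subseteq> {..<8}"
  and cost_cell_expr: "cost cell_expr \<le> 150"
  by (simp_all add: cell_expr_def header_expr_def size_expr_def literal_expr_def column_expr_def
      block_expr_def col_expr_def entry_expr_def index_expr_def)

section \<open>The grammar of an instance and the text that it represents\<close>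

locale ov_instance =
  fixes d n :: nat and xs :: "nat list list"
  assumes d_pos: "d \<ge> 1" and n_pos: "n \<ge> 1"
    and length_xs: "length xs = n" and vecs: "set xs \<subseteq> bin_vecs d"
begin

definition D :: nat where "D = d + 2"

definition A :: nat where "A = n * D"

text \<open>\<open>1 + D\<close> literals, then \<open>A\<close> rules extending columns downwards,
  then \<open>A\<close> rules appending columns on the right.\<close>

definition V :: nat where "V = 1 + D + 2 * A"

definition rows :: "nat list list" where
  "rows = replicate D 1 # map ext xs"

definition entry :: "nat \<Rightarrow> nat" where
  "entry m = ext (xs ! (m div D)) ! (m mod D)"

definition col :: "nat \<Rightarrow> nat" where
  "col m = (if entry m \<noteq> 0 then m mod D else d)"

text \<open>The text row of \<open>v\<close> after \<open>t\<close> columns have been appended. The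
  leading 1 is the entry \<open>v ! (D - 1)\<close> of the column that the text starts from.\<close>

definition row :: "nat \<Rightarrow> nat list \<Rightarrow> nat list" where
  "row t v = 1 # map (\<lambda>m. v ! col m) [0..<t]"

text \<open>Number \<open>1 + j * D + s\<close> stands for the top \<open>j + 1\<close> entries of
  column \<open>s\<close>, so subtracting \<open>D\<close> removes the lowest entry. Block rules are
  numbered by stage, each extending its predecessor.\<close>

definition left_arg :: "nat \<Rightarrow> nat" where
  "left_arg i = (if i < 1 + D + A then i - D else i - 1)"

text \<open>A bit doubles as the number of a literal with that value. Number
  \<open>1 + A + s\<close> is the complete column \<open>s\<close>, because
  \<open>A = n * D\<close>.\<close>

definition right_arg :: "nat \<Rightarrow> nat" where
  "right_arg i =
     (let m = (i - (1 + D)) mod A in if i < 1 + D + A then entry m else 1 + A + col m)"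

definition G :: "(nat, nat) slp2d" where
  "G = \<lparr>Vl = {..<1 + D}, Vh = {1 + D..<1 + D + A}, Vv = {1 + D + A..<V}, alphabet = {0, 1},
        rhs = (\<lambda>i. if i < 1 + D then [Inr (of_bool (i \<noteq> 0))]
                   else [Inl (left_arg i), Inl (right_arg i)]),
        start = V - 1\<rparr>"

lemma G_simps [simp]:
  "Vl G = {..<1 + D}" "Vh G = {1 + D..<1 + D + A}" "Vv G = {1 + D + A..<V}"
  "alphabet G = {0, 1}" "start G = V - 1"
  "rhs G i = (if i < 1 + D then [Inr (of_bool (i \<noteq> 0))] else [Inl (left_arg i), Inl (right_arg i)])"
  by (simp_all add: G_def)

lemma D_gt: "D > 2" "d < D"
  using d_pos by (auto simp: D_def)

lemma A_ge: "D \<le> A"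
  using n_pos by (simp add: A_def)

lemma nonterminals_G: "nonterminals G = {0..<V}"
  using D_gt by (auto simp: nonterminals_def V_def)

lemma vec:
  assumes "j < n"
  shows "length (xs ! j) = d" "s < d \<Longrightarrow> xs ! j ! s \<le> 1"
proof -
  have "xs ! j \<in> bin_vecs d"
    using assms length_xs vecs by auto
  then show "length (xs ! j) = d" "s < d \<Longrightarrow> xs ! j ! s \<le> 1"
    by (auto simp: bin_vecs_def dest!: nth_mem)
qed

lemma ext_nth:
  assumes "j < n" "s < D"
  shows "ext (xs ! j) ! s = (if s < d then xs ! j ! s else s - d)"
proof (cases "s < d")
  case False
  then have "s - d = 0 \<or> s - d = 1"
    using assms by (auto simp: D_def)
  then show ?thesis
    using False vec[OF assms(1)] by (auto simp: ext_def nth_append)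
qed (use vec[OF assms(1)] in \<open>simp add: ext_def nth_append\<close>)

lemma ext_nth_le: "j < n \<Longrightarrow> s < D \<Longrightarrow> ext (xs ! j) ! s \<le> 1"
  using vec(2)[of j s] by (auto simp: ext_nth D_def)

lemma index_less: "m < A \<Longrightarrow> m div D < n" "m mod D < D"
  using D_gt by (auto simp: A_def less_mult_imp_div_less)

lemma entry_eq: "s < D \<Longrightarrow> entry (j * D + s) = ext (xs ! j) ! s"
  by (simp add: entry_def)

lemma entry_le: "m < A \<Longrightarrow> entry m \<le> 1"
  using index_less ext_nth_le by (auto simp: entry_def)

lemma col_less: "col m < D"
  using D_gt by (auto simp: col_def)

lemma rows_nth:
  "rows ! 0 = replicate D 1" "j < n \<Longrightarrow> rows ! Suc j = ext (xs ! j)" "length rows = Suc n"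
  using length_xs by (auto simp: rows_def)

lemma rows_last: "v \<in> set rows \<Longrightarrow> v ! (D - 1) = 1"
proof -
  have "ext x ! (D - 1) = 1" if x: "x \<in> set xs" for x
  proof -
    obtain j where j: "j < n" "x = xs ! j"
      using x length_xs by (auto simp: set_conv_nth)
    have "D - 1 < D" "\<not> D - 1 < d" "D - 1 - d = 1"
      by (auto simp: D_def)
    then show ?thesis
      using ext_nth[OF j(1), of "D - 1"] j(2) by simp
  qed
  then show "v \<in> set rows \<Longrightarrow> v ! (D - 1) = 1"
    using D_gt by (auto simp: rows_def)
qed

lemma expands_lit: "i < 1 + D \<Longrightarrow> expands G i [[of_bool (i \<noteq> 0)]]"
  by (intro expands.lit) auto

text \<open>Induction on the rows. The base is the literal \<open>1 + s\<close>, which supplies the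
  1 of the top row; each step puts the literal of the next coordinate below.\<close>

lemma expands_column:
  assumes "j \<le> n" "s < D"
  shows "expands G (1 + j * D + s) (map (\<lambda>v. [v ! s]) (take (Suc j) rows))"
  using assms(1)
proof (induction j)
  case 0
  then show ?case
    using expands_lit[of "1 + s"] assms(2) by (simp add: rows_def)
next
  case (Suc j)
  define i where "i = 1 + Suc j * D + s"
  have "Suc j * D \<le> A"
    unfolding A_def using Suc.prems by (intro mult_le_mono) auto
  then have i: "1 + D \<le> i" "i < 1 + D + A" and m: "j * D + s < A"
    using assms(2) by (auto simp: i_def)
  have "left_arg i = 1 + j * D + s" "(i - (1 + D)) mod A = j * D + s"
    using i m by (auto simp: left_arg_def i_def)
  then have args: "left_arg i = 1 + j * D + s" "right_arg i = ext (xs ! j) ! s"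
    using i assms(2) by (auto simp: right_arg_def entry_eq)
  define v where "v = ext (xs ! j) ! s"
  have "v \<le> 1"
    using ext_nth_le[of j s] Suc.prems assms(2) by (simp add: v_def)
  then have "expands G v [[v]]"
    using expands_lit[of v] D_gt by (cases "v = 0") (auto simp: le_Suc_eq)
  then have "expands G i (map (\<lambda>v. [v ! s]) (take (Suc j) rows) @ [[v]])"
    using i args Suc
    by (intro expands.hor[where A = "1 + j * D + s" and B = v])
      (auto simp: v_def ncols_def rows_def)
  moreover have "take (Suc (Suc j)) rows = take (Suc j) rows @ [ext (xs ! j)]"
    using Suc.prems rows_nth by (subst take_Suc_conv_app_nth) auto
  ultimately show ?case
    by (simp add: i_def v_def)
qed

lemma expands_full_column: "s < D \<Longrightarrow> expands G (1 + A + s) (map (\<lambda>v. [v ! s]) rows)"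
  using expands_column[of n s] rows_nth(3) by (simp add: A_def)

text \<open>Induction on the number of appended columns. Stage 0 is the complete column
  \<open>D - 1\<close>, which consists of ones; its number \<open>1 + A + (D - 1)\<close> is just
  below the first block rule.\<close>

lemma expands_block: "t \<le> A \<Longrightarrow> expands G (D + A + t) (map (row t) rows)"
proof (induction t)
  case 0
  have "map (\<lambda>v. [v ! (D - 1)]) rows = map (row 0) rows"
    using rows_last by (auto simp: row_def)
  moreover have "expands G (1 + A + (D - 1)) (map (\<lambda>v. [v ! (D - 1)]) rows)"
    using D_gt by (intro expands_full_column) simp
  moreover have "1 + A + (D - 1) = D + A + 0"
    using D_gt by simp
  ultimately show ?case by (simp only:)
next
  case (Suc t)
  define i where "i = D + A + Suc t"
  have i: "1 + D + A \<le> i" "i < V"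
    using Suc.prems by (auto simp: i_def V_def)
  have "(i - (1 + D)) mod A = t"
    using Suc.prems by (simp add: i_def)
  then have args: "left_arg i = D + A + t" "right_arg i = 1 + A + col t"
    using i by (auto simp: left_arg_def right_arg_def i_def)
  have "expands G i (map2 (@) (map (row t) rows) (map (\<lambda>v. [v ! col t]) rows))"
    using i args Suc expands_full_column[OF col_less]
    by (intro expands.ver[where A = "D + A + t" and B = "1 + A + col t"])
      (auto simp: nrows_def)
  then show ?case
    by (simp add: i_def map2_map_map row_def comp_def)
qed

lemma represents_G: "represents G (map (row A) rows)"
  using expands_block[of A] by (simp add: represents_def V_def mult_2 add.assoc)

lemma expands_ex:
  assumes "i < V"
  shows "\<exists>X. expands G i X"
proof -
  consider "i = 0" | "0 < i" "i \<le> D + A" | "D + A < i"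
    by linarith
  then show ?thesis
  proof cases
    case 2
    \<comment> \<open>Quotient and remainder of \<open>i - 1\<close> by \<open>D\<close> recover the
      row and the column; the row is at most \<open>n\<close> because
      \<open>D + A = (n + 1) * D\<close>.\<close>
    then have "(i - 1) div D < n + 1"
      using D_gt by (intro less_mult_imp_div_less) (simp add: A_def)
    then have "expands G (1 + (i - 1) div D * D + (i - 1) mod D)
        (map (\<lambda>v. [v ! ((i - 1) mod D)]) (take (Suc ((i - 1) div D)) rows))"
      using D_gt by (intro expands_column) auto
    moreover have "1 + (i - 1) div D * D + (i - 1) mod D = i"
      using 2 by simp
    ultimately show ?thesis by auto
  next
    case 3
    then have "i - (D + A) \<le> A" "D + A + (i - (D + A)) = i"
      using assms by (auto simp: V_def)
    then show ?thesis
      using expands_block[of "i - (D + A)"] by auto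
  qed (use expands_lit in auto)
qed

lemma args_less: "1 + D \<le> i \<Longrightarrow> i < V \<Longrightarrow> left_arg i < i \<and> right_arg i < i"
proof -
  assume i: "1 + D \<le> i" "i < V"
  have m: "(i - (1 + D)) mod A < A"
    using A_ge D_gt by simp
  then show ?thesis
    using i entry_le[OF m] col_less[of "(i - (1 + D)) mod A"] D_gt
    by (auto simp: left_arg_def right_arg_def Let_def)
qed

lemma wf_G: "wf_slp2d G"
proof -
  \<comment> \<open>Arguments have smaller numbers than their rule, whereas the ordering must place
    them later.\<close>
  define Ns where "Ns = rev [0..<V]"
  have Ns: "distinct Ns" "set Ns = nonterminals G"
    by (auto simp: Ns_def nonterminals_G)
  have nth: "Ns ! i = V - Suc i" if "i < V" for i
    using that by (simp add: Ns_def rev_nth)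
  have order: "\<exists>j<length Ns. i < j \<and> Ns ! j = B"
    if "i < length Ns" "Ns ! i \<in> Vh G \<union> Vv G" "Inl B \<in> set (rhs G (Ns ! i))" for i B
  proof -
    have i: "i < V" "Ns ! i = V - Suc i"
      using that(1) nth by (auto simp: Ns_def)
    have "1 + D \<le> Ns ! i" "Ns ! i < V"
      using that(2) by (auto simp: V_def)
    then have "B < Ns ! i"
      using that(3) args_less[of "Ns ! i"] by auto
    then show ?thesis
      using i nth[of "V - Suc B"] by (intro exI[of _ "V - Suc B"]) (auto simp: Ns_def)
  qed
  have "\<exists>B\<in>nonterminals G. \<exists>C\<in>nonterminals G. rhs G N = [Inl B, Inl C]"
    if "N \<in> Vh G \<union> Vv G" for N
  proof -
    have "1 + D \<le> N" "N < V"
      using that by (auto simp: V_def)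
    then show ?thesis
      using args_less[of N] by (auto simp: nonterminals_G)
  qed
  moreover have "\<exists>a\<in>alphabet G. rhs G N = [Inr a]" if "N \<in> Vl G" for N
    using that by auto
  moreover have "V > 0" by (simp add: V_def)
  ultimately show ?thesis
    unfolding wf_slp2d_def using Ns order expands_ex
    by (intro conjI exI[of _ Ns]) (auto simp: nonterminals_G simp del: G_simps(6))
qed

lemma slp_size_G: "slp_size G \<le> 2 * V" "slp_size G \<ge> 1"
proof -
  have "slp_size G \<le> (\<Sum>i\<in>{0..<V}. 2)"
    unfolding slp_size_def nonterminals_G by (intro sum_mono) auto
  then show "slp_size G \<le> 2 * V" by simp
  have "(\<Sum>i\<in>{0..<V}. 1) \<le> slp_size G"
    unfolding slp_size_def nonterminals_G by (intro sum_mono) auto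
  then show "slp_size G \<ge> 1" by (simp add: V_def)
qed

section \<open>Zero runs in the text and orthogonal pairs\<close>

definition P :: "nat list" where "P = replicate (d + 1) 0"

lemma row_nth: "row A v ! 0 = 1" "m < A \<Longrightarrow> row A v ! Suc m = v ! col m"
  by (auto simp: row_def)

lemma col_eq: "y < n \<Longrightarrow> s < D \<Longrightarrow>
    col (y * D + s) = (if (if s < d then xs ! y ! s else s - d) \<noteq> 0 then s else d)"
  by (simp add: col_def entry_eq ext_nth)

lemma block_le: "y < n \<Longrightarrow> y * D + D \<le> A"
  using mult_le_mono1[of "Suc y" n D] by (simp add: A_def add.commute)

text \<open>A run of \<open>d + 1\<close> zeros avoids the leading 1 and the last entry of every
  block, which is 1, so it fills the first \<open>d + 1\<close> of the \<open>d + 2\<close> entries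
  of one block. There, coordinate \<open>s < d\<close> is the product of the bits of the two
  vectors: column \<open>d\<close>, chosen if the bit of \<open>y\<close> is 0, is zero in every row
  \<open>ext x\<close>.\<close>

lemma zero_run_iff:
  "(\<exists>v\<in>set rows. \<exists>j. j + d \<le> A \<and> (\<forall>t\<le>d. row A v ! (j + t) = 0)) \<longleftrightarrow>
   (\<exists>x\<in>set xs. \<exists>y\<in>set xs. dot x y = 0)" (is "?L \<longleftrightarrow> ?R")
proof
  assume ?L
  then obtain v j where v: "v \<in> set rows" and j: "j + d \<le> A"
    and zero: "\<And>t. t \<le> d \<Longrightarrow> row A v ! (j + t) = 0"
    by auto
  have "j \<noteq> 0"
    using zero[of 0] row_nth(1)[of v] by (cases j) auto
  then obtain m where jm: "j = Suc m"
    by (cases j) auto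
  have mt: "m + t < A" "v ! col (m + t) = 0" if "t \<le> d" for t
    using zero[OF that] row_nth(2)[of "m + t" v] j jm that by auto
  define y where "y = m div D"
  have y: "y < n"
    using index_less(1)[of m] mt(1)[of 0] by (simp add: y_def)
  have "m mod D = 0"
  proof (rule ccontr)
    assume nz: "m mod D \<noteq> 0"
    \<comment> \<open>\<open>t\<close> is the distance to the last entry of the block. It is at most
      \<open>d\<close> as \<open>m mod D\<close> is positive, so the run would contain a 1.\<close>
    define t where "t = D - 1 - m mod D"
    have t: "t \<le> d"
      using nz by (simp add: t_def D_def)
    have "m mod D + t = D - 1"
      using index_less(2)[of m] by (simp add: t_def)
    moreover have "m = y * D + m mod D"
      by (simp add: y_def)
    ultimately have "m + t = y * D + (D - 1)"
      by linarith
    then have "col (m + t) = D - 1"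
      using col_eq[OF y, of "D - 1"] by (simp add: D_def)
    then show False
      using mt(2)[OF t] rows_last[OF v] by simp
  qed
  then have m: "m = y * D"
    using mult_div_mod_eq[of D m] by (simp add: y_def mult.commute)
  obtain x where x: "x \<in> set xs" "v = ext x"
  proof -
    \<comment> \<open>The top row consists of ones and contains no zero run.\<close>
    have "v \<noteq> replicate D 1"
      using mt(2)[of 0] col_less[of m] by auto
    then show thesis
      using that v by (auto simp: rows_def)
  qed
  have lx: "length x = d"
    using x vecs by (auto simp: bin_vecs_def)
  have "x ! s * xs ! y ! s = 0" if "s < d" for s
  proof (cases "xs ! y ! s = 0")
    case False
    then have "col (m + s) = s"
      using col_eq[OF y, of s] that by (simp add: m D_def)
    then show ?thesis
      using mt(2)[of s] that x(2) lx by (simp add: ext_def nth_append)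
  qed simp
  then have "dot x (xs ! y) = 0"
    by (simp add: dot_def lx)
  moreover have "xs ! y \<in> set xs"
    using y length_xs by simp
  ultimately show ?R
    using x(1) by blast
next
  assume ?R
  then obtain x y where x: "x \<in> set xs" and y: "y < n" and dot: "dot x (xs ! y) = 0"
    using length_xs by (metis in_set_conv_nth)
  have lx: "length x = d"
    using x vecs by (auto simp: bin_vecs_def)
  have "row A (ext x) ! (Suc (y * D) + t) = 0" if t: "t \<le> d" for t
  proof -
    have "col (y * D + t) = (if (if t < d then xs ! y ! t else t - d) \<noteq> 0 then t else d)"
      using t by (intro col_eq[OF y]) (simp add: D_def)
    moreover have "x ! t * xs ! y ! t = 0" if "t < d"
      using dot that by (simp add: dot_def lx)
    ultimately have "ext x ! col (y * D + t) = 0"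
      using t lx by (auto simp: ext_def nth_append)
    then show ?thesis
      using row_nth(2)[of "y * D + t"] block_le[OF y] t by (simp add: D_def)
  qed
  moreover have "Suc (y * D) + d \<le> A"
    using block_le[OF y] by (simp add: D_def)
  moreover have "ext x \<in> set rows"
    using x by (simp add: rows_def)
  ultimately show ?L by blast
qed

lemma occurs_P_iff:
  "occurs P (map (row A) rows) \<longleftrightarrow> (\<exists>x\<in>set xs. \<exists>y\<in>set xs. dot x y = 0)"
proof -
  have "ncols (map (row A) rows) = A + 1"
    by (simp add: ncols_def rows_def row_def)
  then have "occurs P (map (row A) rows) \<longleftrightarrow>
      (\<exists>i<length rows. \<exists>j. j + d \<le> A \<and> (\<forall>t\<le>d. row A (rows ! i) ! (j + t) = 0))"
    unfolding occurs_iff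
    by (intro ex_cong1) (simp add: nrows_def P_def less_Suc_eq_le del: replicate_Suc cong: conj_cong)
  also have "\<dots> \<longleftrightarrow> (\<exists>v\<in>set rows. \<exists>j. j + d \<le> A \<and> (\<forall>t\<le>d. row A v ! (j + t) = 0))"
    by (metis in_set_conv_nth)
  finally show ?thesis
    by (simp only: zero_run_iff)
qed

section \<open>Memory contents and correctness of the rewriting program\<close>

definition inp :: "nat list" where "inp = ov_input d xs"

definition outp :: "nat list" where "outp = matching_input P G"

definition L :: nat where "L = d + 4 + 3 * V"

lemma inp_nth:
  "inp ! 0 = n" "inp ! 1 = d"
  "j < n \<Longrightarrow> s < d \<Longrightarrow> inp ! (2 + j * d + s) = xs ! j ! s"
  using nth_concat_uniform[of xs d j s] vecs length_xs
  by (auto simp: inp_def ov_input_def bin_vecs_def add.assoc)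

lemma length_inp: "length inp = 2 + n * d"
  using length_concat_uniform[of xs d] vecs length_xs
  by (auto simp: inp_def ov_input_def bin_vecs_def)

lemma length_rule_code: "length (rule_code G i) = 3"
  by (simp add: rule_code_def)

lemma rule_code_eq:
  "rule_code G i =
     (if i < 1 + D then [0, of_bool (i \<noteq> 0), 0]
      else [if i < 1 + D + A then 1 else 2, left_arg i, right_arg i])"
  by (simp add: rule_code_def)

lemma length_outp: "length outp = L"
proof -
  have "length (concat (map (rule_code G) [0..<V])) = V * 3"
    using length_concat_uniform[of "map (rule_code G) [0..<V]" 3] length_rule_code by auto
  then show ?thesis
    by (simp add: outp_def matching_input_def nonterminals_G P_def L_def)
qed

lemma outp_nth:
  "outp ! 0 = d + 1" "0 < a \<Longrightarrow> a < d + 2 \<Longrightarrow> outp ! a = 0"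
  "outp ! (d + 2) = V" "outp ! (d + 3) = V - 1"
  "i < V \<Longrightarrow> q < 3 \<Longrightarrow> outp ! (d + 4 + 3 * i + q) = rule_code G i ! q"
proof -
  have outp: "outp = ((d + 1) # P @ [V, V - 1]) @ concat (map (rule_code G) [0..<V])"
    by (simp add: outp_def matching_input_def nonterminals_G P_def)
  show "outp ! 0 = d + 1" by (simp add: outp)
  show "0 < a \<Longrightarrow> a < d + 2 \<Longrightarrow> outp ! a = 0"
    by (auto simp: outp P_def nth_Cons' nth_append)
  show "outp ! (d + 2) = V" "outp ! (d + 3) = V - 1"
    by (auto simp: outp P_def nth_Cons' nth_append)
  assume iq: "i < V" "q < 3"
  have "outp ! (d + 4 + 3 * i + q) = concat (map (rule_code G) [0..<V]) ! (i * 3 + q)"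
    unfolding outp by (subst nth_append) (simp add: P_def mult.commute)
  also have "\<dots> = map (rule_code G) [0..<V] ! i ! q"
    using iq length_rule_code by (intro nth_concat_uniform) auto
  finally show "outp ! (d + 4 + 3 * i + q) = rule_code G i ! q"
    using iq by simp
qed

lemma size_bounds:
  "length inp \<le> L" "1 + D + A \<le> L" "V \<le> L" "d + 4 \<le> L" "4 \<le> L"
  by (auto simp: length_inp L_def V_def A_def D_def algebra_simps)

text \<open>The memory when the cells from address \<open>c\<close> on have been rewritten.\<close>

definition mem :: "nat \<Rightarrow> nat \<Rightarrow> nat" where
  "mem c a = snd (init_state (if a < c then inp else outp)) a"

text \<open>The instance is no longer than \<open>L\<close>, so nothing of it remains behind the
  target.\<close>

lemma mem_L: "init_state inp = (\<lambda>_. 0, mem L)"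
  using size_bounds(1) length_outp by (auto simp: init_state_def mem_def fun_eq_iff)

lemma mem_0: "init_state outp = (\<lambda>_. 0, mem 0)"
  by (auto simp: init_state_def mem_def fun_eq_iff)

lemma mem_Suc: "c < L \<Longrightarrow> (mem (Suc c))(c := outp ! c) = mem c"
  using length_outp by (auto simp: mem_def fun_eq_iff init_state_def)

lemma mem_inp: "a < c \<Longrightarrow> a < length inp \<Longrightarrow> mem c a = inp ! a"
  by (simp add: mem_def init_state_def)

text \<open>Since \<open>d \<le> D\<close>, the address \<open>2 + j * d + s\<close> is at most
  \<open>m + 2\<close>, hence below the part already rewritten.\<close>

lemma entry_expr:
  assumes R: "R 0 = d" "R 1 = D" "R 7 = m" and m: "m < A" "m + 2 < c" and w: "L < 2 ^ w"
  shows "val (R, mem c) entry_expr = entry m" "fits w (R, mem c) entry_expr"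
proof -
  define j s where "j = m div D" and "s = m mod D"
  have js: "j < n" "s < D" "m = j * D + s"
    using index_less[of m] m by (auto simp: j_def s_def)
  have entry: "entry m = (if s < d then xs ! j ! s else s - d)"
    using ext_nth[of j s] js(1,2) by (simp add: entry_def j_def s_def)
  have "j * d \<le> j * D"
    by (simp add: D_def)
  then have le: "2 + j * d + s < c"
    using m js by linarith
  have le': "2 + j * d + s < length inp" if "s < d"
  proof -
    have "Suc j * d \<le> n * d"
      using js by (intro mult_le_mono1) auto
    then show ?thesis
      using that by (simp add: length_inp)
  qed
  have Ld: "mem c (2 + j * d + s) = xs ! j ! s" if "s < d"
    using mem_inp[OF le le'[OF that]] inp_nth(3)[OF js(1) that] by simp
  have small: "v < 2 ^ w" if "v \<le> L" for v
    using that w by (rule le_less_trans)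
  have "j \<le> m" "s \<le> m"
    by (auto simp: j_def s_def)
  then have bounds: "m \<le> L" "j \<le> L" "s \<le> L" "D \<le> L" "d \<le> L" "2 \<le> L"
    using size_bounds m(1) by linarith+
  have bounds': "2 + j * d + s \<le> L" "2 + j * d \<le> L" "j * d \<le> L" "xs ! j ! s \<le> L" if "s < d"
    using le'[OF that] vec(2)[OF js(1) that] size_bounds(1) bounds(6) by linarith+
  show "val (R, mem c) entry_expr = entry m"
    using R Ld by (simp add: entry_expr_def index_expr_def entry flip: j_def s_def)
  show "fits w (R, mem c) entry_expr"
    using R Ld bounds bounds'
    by (simp add: entry_expr_def index_expr_def small flip: j_def s_def)
qed

text \<open>The cases follow the layout of the target: header, literals, columns, blocks. The values
  computed on the branch taken are at most \<open>L\<close> and therefore fit.\<close>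

lemma cell_expr:
  assumes R: "R 0 = d" "R 1 = D" "R 2 = A" "R 4 = a" "R 5 = (a - (d + 4)) div 3"
      "R 6 = (a - (d + 4)) mod 3" "R 7 = (R 5 - (1 + D)) mod A"
    and a: "a < L" and w: "L < 2 ^ w"
  shows "val (R, mem (Suc a)) cell_expr = outp ! a \<and> fits w (R, mem (Suc a)) cell_expr"
proof -
  have small: "v < 2 ^ w" if "v \<le> L" for v
    using that w by (rule le_less_trans)
  have V: "1 + D + 2 * A = V" "1 \<le> V"
    by (simp_all add: V_def)
  have bounds: "d + 4 \<le> L" "d + 3 \<le> L" "d + 2 \<le> L" "d + 1 \<le> L" "d \<le> L" "D \<le> L" "A \<le> L"
    "1 + D \<le> L" "2 * A \<le> L" "1 + A \<le> L" "1 + D + A \<le> L" "V \<le> L" "0 \<le> L" "1 \<le> L"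
    "2 \<le> L" "3 \<le> L" "4 \<le> L" "a \<le> L"
    using size_bounds V a by linarith+
  note fit = bounds[THEN small]
  show ?thesis
  proof (cases "a < d + 4")
    case True
    have cell: "val (R, mem (Suc a)) cell_expr = val (R, mem (Suc a)) header_expr"
      "fits w (R, mem (Suc a)) cell_expr = fits w (R, mem (Suc a)) header_expr"
      using True R(1,4) fit by (simp_all add: cell_expr_def)
    consider "a = 0" | "0 < a" "a < d + 2" | "a = d + 2" | "a = d + 3"
      using True by linarith
    then show ?thesis
    proof cases
      case 1
      then show ?thesis
        unfolding cell using R(1-4) fit outp_nth(1) by (simp add: header_expr_def)
    next
      case 2
      then show ?thesis
        unfolding cell using R(1-4) fit outp_nth(2)[of a] small[of a] bounds(18)
        by (simp add: header_expr_def)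
    next
      case 3
      then show ?thesis
        unfolding cell using R(1-4) fit outp_nth(3) V
        by (simp add: header_expr_def size_expr_def)
    next
      case 4
      then show ?thesis
        unfolding cell using R(1-4) fit outp_nth(4) V small[of "V - 1"]
        by (simp add: header_expr_def size_expr_def)
    qed
  next
    case False
    define i q m where "i = (a - (d + 4)) div 3" and "q = (a - (d + 4)) mod 3"
      and "m = (i - (1 + D)) mod A"
    have R': "R 5 = i" "R 6 = q" "R 7 = m"
      using R by (simp_all add: i_def q_def m_def)
    have q: "q < 3" and "a - (d + 4) = 3 * i + q"
      by (simp_all add: i_def q_def)
    then have aeq: "a = d + 4 + 3 * i + q"
      using False by linarith
    then have i: "i < V" "i \<le> a"
      using a by (auto simp: L_def)
    have outp: "outp ! a = rule_code G i ! q"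
      unfolding aeq using outp_nth(5)[OF i(1) q] .
    have q_cases: "q = 0 \<or> q = 1 \<or> q = 2"
      using q by linarith
    have fit_a: "a - (d + 3) < 2 ^ w" and fit_b: "1 + D + A - i < 2 ^ w"
      using bounds(11,18) by (auto intro!: small simp del: One_nat_def)
    have fit': "i < 2 ^ w" "i - D < 2 ^ w" "i - 1 < 2 ^ w" "q < 2 ^ w" "q - 1 < 2 ^ w" "m < 2 ^ w"
    proof -
      have "m \<le> i"
        unfolding m_def by (rule order.trans[OF mod_less_eq_dividend]) simp
      moreover have "q \<le> L"
        using q bounds by linarith
      ultimately show "i < 2 ^ w" "i - D < 2 ^ w" "i - 1 < 2 ^ w" "q < 2 ^ w" "q - 1 < 2 ^ w"
        "m < 2 ^ w"
        using i(2) bounds(18) by (auto intro!: small)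
    qed
    show ?thesis
    proof (cases "i < 1 + D")
      case True
      then have cell: "val (R, mem (Suc a)) cell_expr = val (R, mem (Suc a)) literal_expr"
        "fits w (R, mem (Suc a)) cell_expr = fits w (R, mem (Suc a)) literal_expr"
        using False R(1-4) R' fit fit' fit_a by (simp_all add: cell_expr_def)
      show ?thesis
        unfolding cell outp using True q_cases R' fit fit'
        by (auto simp: literal_expr_def rule_code_eq)
    next
      case i_ge: False
      have m: "m < A"
        using A_ge D_gt by (simp add: m_def)
      \<comment> \<open>With \<open>a = d + 4 + 3 * i + q\<close> this puts the cell above the
        coordinate that it reads, which is therefore still intact.\<close>
      have "m \<le> i - (1 + D)"
        by (simp add: m_def)
      then have "m + 2 < Suc a"
        using aeq by linarith
      note entry = entry_expr[OF R(1,2) R'(3) m this w]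
      show ?thesis
      proof (cases "i < 1 + D + A")
        case True
        then have cell: "val (R, mem (Suc a)) cell_expr = val (R, mem (Suc a)) column_expr"
          "fits w (R, mem (Suc a)) cell_expr = fits w (R, mem (Suc a)) column_expr"
          using False i_ge R(1-4) R' fit fit' fit_a fit_b
          by (simp_all add: cell_expr_def)
        show ?thesis
          unfolding cell outp using True i_ge q_cases R(1-4) R' fit fit' entry
          by (auto simp: column_expr_def rule_code_eq left_arg_def right_arg_def m_def)
      next
        case i_ge': False
        then have cell: "val (R, mem (Suc a)) cell_expr = val (R, mem (Suc a)) block_expr"
          "fits w (R, mem (Suc a)) cell_expr = fits w (R, mem (Suc a)) block_expr"
          using False i_ge R(1-4) R' fit fit' fit_a fit_b
          by (simp_all add: cell_expr_def)
        have col: "val (R, mem (Suc a)) col_expr = col m"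
          "fits w (R, mem (Suc a)) col_expr"
          using R(1-4) R' fit fit' entry index_less(2)[of m]
          by (auto simp: col_expr_def index_expr_def col_def intro: less_trans)
        have "1 + A + col m < 2 ^ w"
          using col_less[of m] size_bounds by (intro small) linarith
        then show ?thesis
          unfolding cell outp using i_ge i_ge' q_cases R(1-4) R' fit fit' col
          by (auto simp: block_expr_def rule_code_eq left_arg_def right_arg_def m_def)
      qed
    qed
  qed
qed

text \<open>At most \<open>4 * 10 + 150 + 2\<close> steps, rounded up to 300; all evaluation stacks
  end below register 200.\<close>

lemma runs_rewrite_cell:
  assumes R: "R 0 = d" "R 1 = D" "R 2 = A" "R 3 = Suc a" and a: "a < L" and w: "L < 2 ^ w"
  shows "\<exists>R'. runs w rewrite_cell (R, mem (Suc a)) 300 (R', mem a) \<and>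
    R' 0 = d \<and> R' 1 = D \<and> R' 2 = A \<and> R' 3 = a \<and> (\<forall>x\<ge>200. R' x = R x)"
proof -
  let ?M = "mem (Suc a)"
  have small: "v < 2 ^ w" if "v \<le> L" for v
    using that w by (rule le_less_trans)
  have bounds: "d + 4 \<le> L" "d \<le> L" "D \<le> L" "A \<le> L" "1 + D \<le> L" "1 \<le> L" "3 \<le> L" "4 \<le> L"
    "a \<le> L" "Suc a \<le> L" "a - (d + 4) \<le> L"
    using size_bounds a by linarith+
  note fit = bounds[THEN small]
  define i q m where "i = (a - (d + 4)) div 3" and "q = (a - (d + 4)) mod 3"
    and "m = (i - (1 + D)) mod A"
  have "i \<le> a - (d + 4)" "q \<le> a - (d + 4)" "m \<le> i - (1 + D)"
    by (auto simp: i_def q_def m_def)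
  then have "i \<le> L" "q \<le> L" "m \<le> L" "i - (1 + D) \<le> L"
    using bounds(11) by linarith+
  note fit' = this[THEN small]
  have 1: "fits w (R, ?M) address_expr" "val (R, ?M) address_expr = a"
    "vars address_expr \<subseteq> {..<4}" "cost address_expr \<le> 10" "(4::nat) + 10 \<le> 200"
    using R fit by (simp_all add: address_expr_def)
  then obtain R1 where R1: "runs w (compile address_expr 4) (R, ?M) 10 (R1, ?M)"
    "R1 4 = a" "\<And>x. x < 4 \<or> 200 \<le> x \<Longrightarrow> R1 x = R x"
    using runs_compile_below[OF 1] by blast
  have R1': "R1 0 = d" "R1 1 = D" "R1 2 = A"
    using R R1(3) by auto
  have 2: "fits w (R1, ?M) rule_expr" "val (R1, ?M) rule_expr = i"
    "vars rule_expr \<subseteq> {..<5}" "cost rule_expr \<le> 10" "(5::nat) + 10 \<le> 200"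
    using R1(2) R1' fit fit' by (simp_all add: rule_expr_def offset_expr_def i_def)
  then obtain R2 where R2: "runs w (compile rule_expr 5) (R1, ?M) 10 (R2, ?M)"
    "R2 5 = i" "\<And>x. x < 5 \<or> 200 \<le> x \<Longrightarrow> R2 x = R1 x"
    using runs_compile_below[OF 2] by blast
  have R2': "R2 0 = d" "R2 1 = D" "R2 2 = A" "R2 4 = a"
    using R1' R1(2) R2(3) by auto
  have 3: "fits w (R2, ?M) position_expr" "val (R2, ?M) position_expr = q"
    "vars position_expr \<subseteq> {..<6}" "cost position_expr \<le> 10" "(6::nat) + 10 \<le> 200"
    using R2' fit fit' by (simp_all add: position_expr_def offset_expr_def q_def)
  then obtain R3 where R3: "runs w (compile position_expr 6) (R2, ?M) 10 (R3, ?M)"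
    "R3 6 = q" "\<And>x. x < 6 \<or> 200 \<le> x \<Longrightarrow> R3 x = R2 x"
    using runs_compile_below[OF 3] by blast
  have R3': "R3 0 = d" "R3 1 = D" "R3 2 = A" "R3 4 = a" "R3 5 = i"
    using R2' R2(2) R3(3) by auto
  have 4: "fits w (R3, ?M) vector_expr" "val (R3, ?M) vector_expr = m"
    "vars vector_expr \<subseteq> {..<7}" "cost vector_expr \<le> 10" "(7::nat) + 10 \<le> 200"
    using R3' fit fit' by (simp_all add: vector_expr_def m_def)
  then obtain R4 where R4: "runs w (compile vector_expr 7) (R3, ?M) 10 (R4, ?M)"
    "R4 7 = m" "\<And>x. x < 7 \<or> 200 \<le> x \<Longrightarrow> R4 x = R3 x"
    using runs_compile_below[OF 4] by blast
  have R4': "R4 0 = d" "R4 1 = D" "R4 2 = A" "R4 4 = a" "R4 5 = i" "R4 6 = q"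
    using R3' R3(2) R4(3) by auto
  have "val (R4, ?M) cell_expr = outp ! a \<and> fits w (R4, ?M) cell_expr"
    using R4' R4(2) by (intro cell_expr[OF _ _ _ _ _ _ _ a w]) (simp_all add: i_def q_def m_def)
  then have 5: "fits w (R4, ?M) cell_expr" "val (R4, ?M) cell_expr = outp ! a"
    "vars cell_expr \<subseteq> {..<8}" "cost cell_expr \<le> 150" "(8::nat) + 150 \<le> 200"
    using vars_cell_expr cost_cell_expr by simp_all
  then obtain R5 where R5: "runs w (compile cell_expr 8) (R4, ?M) 150 (R5, ?M)"
    "R5 8 = outp ! a" "\<And>x. x < 8 \<or> 200 \<le> x \<Longrightarrow> R5 x = R4 x"
    using runs_compile_below[OF 5] by blast
  have "R5 4 = a"
    using R5(3)[of 4] R4'(4) by simp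
  then have S: "runs w (Store 4 8) (R5, ?M) 1 (R5, mem a)"
    using runs_Store[of w 4 8 R5 ?M] R5(2) mem_Suc[OF a] by simp
  have "runs w (Op Or 3 4 4) (R5, mem a) 1 (R5(3 := a), mem a)"
    using runs_Op[of Or R5 4 4 w 3 "mem a"] \<open>R5 4 = a\<close> fit by simp
  then have "runs w rewrite_cell (R, ?M) 300 (R5(3 := a), mem a)"
    unfolding rewrite_cell_def
    by (intro runs_Seq[OF R1(1)] runs_Seq[OF R2(1)] runs_Seq[OF R3(1)] runs_Seq[OF R4(1)]
        runs_Seq[OF R5(1)] runs_Seq[OF S]) auto
  moreover have "R5 x = R x" if "x < 3 \<or> 200 \<le> x" for x
    using that R5(3)[of x] R4(3)[of x] R3(3)[of x] R2(3)[of x] R1(3)[of x] by auto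
  ultimately show ?thesis
    using R by (intro exI[of _ "R5(3 := a)"]) auto
qed

text \<open>Each iteration costs 300 steps and a test; the final test adds 1.\<close>

lemma runs_rewrite_loop:
  assumes "R 0 = d" "R 1 = D" "R 2 = A" "R 3 = c" and "c \<le> L" and w: "L < 2 ^ w"
  shows "\<exists>R'. runs w (WhileNz 3 rewrite_cell) (R, mem c) (301 * c + 1) (R', mem 0) \<and>
    (\<forall>x\<ge>200. R' x = R x)"
  using assms(1-5)
proof (induction c arbitrary: R)
  case 0
  then show ?case
    using exec.WhileFalse[of R 3 w rewrite_cell "mem 0"] by (auto intro: runs_exec)
next
  case (Suc c)
  obtain R1 where R1: "runs w rewrite_cell (R, mem (Suc c)) 300 (R1, mem c)"
    "R1 0 = d" "R1 1 = D" "R1 2 = A" "R1 3 = c" "\<And>x. 200 \<le> x \<Longrightarrow> R1 x = R x"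
    using runs_rewrite_cell[of R c] Suc.prems w by auto
  obtain R2 where R2: "runs w (WhileNz 3 rewrite_cell) (R1, mem c) (301 * c + 1) (R2, mem 0)"
    "\<And>x. 200 \<le> x \<Longrightarrow> R2 x = R1 x"
    using Suc.IH[OF R1(2-5)] Suc.prems by auto
  have "runs w (WhileNz 3 rewrite_cell) (R, mem (Suc c)) (301 * Suc c + 1) (R2, mem 0)"
    using Suc.prems(4) by (intro runs_WhileNz_step[OF _ R1(1) R2(1)]) auto
  then show ?case
    using R1(6) R2(2) by auto
qed

lemma runs_reduction:
  assumes c: "runs w c (init_state outp) T s" and w: "L < 2 ^ w"
  shows "runs w (reduction c) (init_state inp) (T + 301 * L + 300) s"
proof -
  have small: "v < 2 ^ w" if "v \<le> L" for v
    using that w by (rule le_less_trans)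
  have len: "1 < length inp" "0 < length inp" "1 < L" "0 < L"
    using size_bounds by (auto simp: length_inp)
  have "n \<le> A"
    by (simp add: A_def D_def)
  then have bounds: "d + 4 \<le> L" "d \<le> L" "D \<le> L" "A \<le> L" "n \<le> L" "1 + D \<le> L" "2 * A \<le> L" "V \<le> L"
    "3 * V \<le> L" "1 \<le> L" "0 \<le> L" "2 \<le> L" "3 \<le> L" "4 \<le> L" "L \<le> L"
    using size_bounds by (auto simp: L_def V_def)
  note fit = bounds[THEN small]
  have input: "mem L 0 = n" "mem L 1 = d"
    using mem_inp[of 0 L] mem_inp[of 1 L] inp_nth len by auto
  let ?R = "\<lambda>_::reg. 0 :: nat"
  let ?M = "mem L"
  have 1: "fits w (?R, ?M) dim_expr" "val (?R, ?M) dim_expr = d"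
    "vars dim_expr \<subseteq> {..<0}" "cost dim_expr \<le> 20" "(0::nat) + 20 \<le> 200"
    using input fit by (simp_all add: dim_expr_def)
  then obtain R1 where R1: "runs w (compile dim_expr 0) (?R, ?M) 20 (R1, ?M)"
    "R1 0 = d" "\<And>x. x < 0 \<or> 200 \<le> x \<Longrightarrow> R1 x = 0"
    using runs_compile_below[OF 1] by blast
  have 2: "fits w (R1, ?M) ext_dim_expr" "val (R1, ?M) ext_dim_expr = D"
    "vars ext_dim_expr \<subseteq> {..<1}" "cost ext_dim_expr \<le> 20" "(1::nat) + 20 \<le> 200"
    using R1(2) fit by (simp_all add: ext_dim_expr_def D_def)
  then obtain R2 where R2: "runs w (compile ext_dim_expr 1) (R1, ?M) 20 (R2, ?M)"
    "R2 1 = D" "\<And>x. x < 1 \<or> 200 \<le> x \<Longrightarrow> R2 x = R1 x"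
    using runs_compile_below[OF 2] by blast
  have 3: "fits w (R2, ?M) total_expr" "val (R2, ?M) total_expr = A"
    "vars total_expr \<subseteq> {..<2}" "cost total_expr \<le> 20" "(2::nat) + 20 \<le> 200"
    using R2(2) input fit by (simp_all add: total_expr_def A_def)
  then obtain R3 where R3: "runs w (compile total_expr 2) (R2, ?M) 20 (R3, ?M)"
    "R3 2 = A" "\<And>x. x < 2 \<or> 200 \<le> x \<Longrightarrow> R3 x = R2 x"
    using runs_compile_below[OF 3] by blast
  have R3': "R3 0 = d" "R3 1 = D"
    using R1(2) R2(2,3) R3(3) by auto
  have V: "1 + D + 2 * A = V" "d + 4 + 3 * V = L"
    by (simp_all add: V_def L_def)
  have 4: "fits w (R3, ?M) counter_expr" "val (R3, ?M) counter_expr = L"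
    "vars counter_expr \<subseteq> {..<3}" "cost counter_expr \<le> 20" "(3::nat) + 20 \<le> 200"
    using R3' R3(2) fit V by (simp_all add: counter_expr_def size_expr_def)
  then obtain R4 where R4: "runs w (compile counter_expr 3) (R3, ?M) 20 (R4, ?M)"
    "R4 3 = L" "\<And>x. x < 3 \<or> 200 \<le> x \<Longrightarrow> R4 x = R3 x"
    using runs_compile_below[OF 4] by blast
  have R4': "R4 0 = d" "R4 1 = D" "R4 2 = A"
    using R3' R3(2) R4(3) by auto
  obtain R5 where R5: "runs w (WhileNz 3 rewrite_cell) (R4, mem L) (301 * L + 1) (R5, mem 0)"
    "\<And>x. x \<ge> 200 \<Longrightarrow> R5 x = R4 x"
    using runs_rewrite_loop[OF R4' R4(2) order.refl w] by blast
  \<comment> \<open>Registers from 200 on still have their initial value 0, so clearing the others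
    gives a genuine initial state for \<open>c\<close>.\<close>
  have "(\<lambda>x. if x < 200 then 0 else R5 x) = (\<lambda>_. 0)"
    using R5(2) R4(3) R3(3) R2(3) R1(3) by (auto simp: fun_eq_iff)
  then have "runs w (clear 200) (R5, mem 0) (Suc 200) (init_state outp)"
    using runs_clear[of w 200 R5 "mem 0"] by (simp only: mem_0)
  then show ?thesis
    unfolding reduction_def mem_L
    by (intro runs_Seq[OF R1(1)] runs_Seq[OF R2(1)] runs_Seq[OF R3(1)] runs_Seq[OF R4(1)]
        runs_Seq[OF R5(1)] runs_Seq[OF _ c]) auto
qed

section \<open>Sizes and running times\<close>

lemma nd_ge: "n \<le> n * d" "d \<le> n * d" "1 \<le> n * d"
  using d_pos n_pos by auto

text \<open>Each of \<open>n\<close>, \<open>d\<close> and \<open>1\<close> is at most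
  \<open>n * d\<close>, and \<open>6 + 12 + 4 + 13 = 35\<close>.\<close>

lemma L_le: "L \<le> 35 * (n * d)"
proof -
  have "L = 6 * (n * d) + 12 * n + 4 * d + 13"
    by (simp add: L_def V_def A_def D_def algebra_simps)
  then show ?thesis
    using nd_ge by linarith
qed

lemma slp_size_le: "slp_size G \<le> 20 * (n * d)"
proof -
  have "V = 2 * (n * d) + 4 * n + d + 3"
    by (simp add: V_def A_def D_def algebra_simps)
  then show ?thesis
    using slp_size_G(1) nd_ge by linarith
qed

text \<open>With \<open>x = n * d\<close> the cube is \<open>(x + 4) ^ 3\<close>, whose terms
  \<open>48 * x + 64\<close> already exceed \<open>35 * x + 2\<close>.\<close>

lemma word_size_outp:
  "word_size k outp \<le> word_size (3 * k + 3) inp" "L < 2 ^ word_size (3 * k + 3) inp"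
proof -
  have "length outp + 2 \<le> (length inp + 2) ^ 3"
    using L_le nd_ge(3) unfolding length_outp length_inp
    by (simp add: power3_eq_cube algebra_simps)
  from word_size_cubic[OF this]
  show "word_size k outp \<le> word_size (3 * k + 3) inp" "L < 2 ^ word_size (3 * k + 3) inp"
    by (simp_all add: length_outp)
qed

lemma answers_reduction:
  assumes "answers c k (matching_input P G) b T"
  shows "answers (reduction c) (3 * k + 3) (ov_input d xs) b (T + 10835 * real (n * d))"
proof -
  obtain t R M where t: "exec (word_size k outp) c (init_state outp) t (R, M)" "real t \<le> T"
    "R 0 = of_bool b"
    using assms by (auto simp: answers_def outp_def)
  have "runs (word_size (3 * k + 3) inp) c (init_state outp) t (R, M)"
    using exec_mono_word[OF t(1) word_size_outp(1)] by (simp add: runs_exec)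
  from runs_reduction[OF this word_size_outp(2)]
  obtain t' where t': "t' \<le> t + 301 * L + 300"
    "exec (word_size (3 * k + 3) inp) (reduction c) (init_state inp) t' (R, M)"
    by (auto simp: runs_def)
  \<comment> \<open>Here \<open>10835 = 301 * 35 + 300\<close>.\<close>
  have "t' \<le> t + 10835 * (n * d)"
    using t'(1) L_le nd_ge(3) by linarith
  then have "real t' \<le> real t + 10835 * real (n * d)"
    by (metis (mono_tags) of_nat_add of_nat_le_iff of_nat_mult of_nat_numeral)
  then have "real t' \<le> T + 10835 * real (n * d)"
    using t(2) by linarith
  then show ?thesis
    using t(3) t'(2) unfolding answers_def inp_def by blast
qed

end

text \<open>Capping \<open>\<epsilon>\<close> at 1 keeps the exponent \<open>p\<close> of
  \<open>n\<close> between 1 and 2. So the linear cost of the reduction is absorbed,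
  \<open>20 powr p\<close> is at most 400, and \<open>d powr p\<close> costs two more factors
  \<open>d\<close>. The factor \<open>2 ^ e\<close> comes from
  \<open>d + 1 \<le> 2 * d\<close>.\<close>

lemma time_bound:
  assumes \<epsilon>: "\<epsilon> > 0" and n: "n \<ge> 1" and d: "d \<ge> 1" and g: "1 \<le> g" "g \<le> 20 * (n * d)"
  shows "K * real g powr (2 - \<epsilon>) * real (d + 1) ^ e + 10835 * real (n * d)
    \<le> (\<bar>K\<bar> * 400 * 2 ^ e + 10835) * real n powr (2 - min \<epsilon> 1) * real d ^ (e + 2)"
proof -
  define p where "p = 2 - min \<epsilon> 1"
  have p: "1 \<le> p" "p \<le> 2" "2 - \<epsilon> \<le> p"
    using \<epsilon> by (auto simp: p_def)
  have "real g powr (2 - \<epsilon>) \<le> real g powr p"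
    using g p by (intro powr_mono) auto
  also have "\<dots> \<le> (20 * (real n * real d)) powr p"
    using g p of_nat_mono[OF g(2), where 'a = real] by (intro powr_mono2) auto
  also have "\<dots> = 20 powr p * (real n powr p * real d powr p)"
    by (simp add: powr_mult)
  also have "\<dots> \<le> 20 powr 2 * (real n powr p * real d powr 2)"
    using p d by (intro mult_mono powr_mono mult_left_mono) auto
  also have "\<dots> = 400 * real n powr p * real d ^ 2"
    using d by (simp add: powr_numeral)
  finally have g_le: "real g powr (2 - \<epsilon>) \<le> 400 * real n powr p * real d ^ 2" .
  have "real (d + 1) ^ e \<le> (2 * real d) ^ e"
    using d by (intro power_mono) auto
  then have d_le: "real (d + 1) ^ e \<le> 2 ^ e * real d ^ e"
    by (simp add: power_mult_distrib)
  \<comment> \<open>\<open>K\<close> may be negative; its absolute value makes the products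
    monotone.\<close>
  have "K * real g powr (2 - \<epsilon>) * real (d + 1) ^ e \<le> \<bar>K\<bar> * real g powr (2 - \<epsilon>) * real (d + 1) ^ e"
    by (intro mult_right_mono) auto
  also have "\<dots> \<le> \<bar>K\<bar> * (400 * real n powr p * real d ^ 2) * (2 ^ e * real d ^ e)"
    using g_le d_le by (intro mult_mono) auto
  also have "\<dots> = \<bar>K\<bar> * 400 * 2 ^ e * (real n powr p * real d ^ (e + 2))"
    by (simp add: power_add power2_eq_square)
  finally have 1: "K * real g powr (2 - \<epsilon>) * real (d + 1) ^ e
      \<le> \<bar>K\<bar> * 400 * 2 ^ e * (real n powr p * real d ^ (e + 2))" .
  have "real n \<le> real n powr p"
    using powr_mono[of 1 p "real n"] n p by simp
  moreover have "real d \<le> real d ^ (e + 2)"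
    using d power_increasing[of 1 "e + 2" "real d"] by simp
  ultimately have "real (n * d) \<le> real n powr p * real d ^ (e + 2)"
    unfolding of_nat_mult by (intro mult_mono) auto
  with 1 show ?thesis
    by (simp add: p_def algebra_simps)
qed

lemma solves_OV_of_solves_matching:
  assumes "\<epsilon> > 0" "solves_matching \<epsilon> e c k"
  shows "solves_OV (min \<epsilon> 1) (e + 2) (reduction c) (3 * k + 3)"
proof -
  obtain K where K: "\<And>P G T. P \<noteq> [] \<Longrightarrow> set P \<subseteq> {0, 1} \<Longrightarrow> wf_slp2d G \<Longrightarrow> alphabet G = {0, 1} \<Longrightarrow>
      nonterminals G = {0..<card (nonterminals G)} \<Longrightarrow> represents G T \<Longrightarrow>
      answers c k (matching_input P G) (occurs P T)
        (K * real (slp_size G) powr (2 - \<epsilon>) * real (length P) ^ e)"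
    using assms(2) unfolding solves_matching_def by blast
  \<comment> \<open>The constant depends on \<open>K\<close> and \<open>e\<close> only, so it is
    fixed before the dimension function.\<close>
  define K' where "K' = \<bar>K\<bar> * 400 * 2 ^ e + 10835"
  have "answers (reduction c) (3 * k + 3) (ov_input d xs) (\<exists>x\<in>set xs. \<exists>y\<in>set xs. dot x y = 0)
      (K' * real (card (set xs)) powr (2 - min \<epsilon> 1) * real d ^ (e + 2))"
    if "1 \<le> d" "1 \<le> card (set xs)" "set xs \<subseteq> bin_vecs d" "distinct xs" for d xs
  proof -
    \<comment> \<open>Distinctness identifies the number of vectors with the length of the
      list.\<close>
    interpret ov_instance d "card (set xs)" xs
      using that by unfold_locales (auto simp: distinct_card)
    have P: "P \<noteq> []" "set P \<subseteq> {0, 1}" "length P = d + 1"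
      by (auto simp: P_def)
    have "answers c k (matching_input P G) (\<exists>x\<in>set xs. \<exists>y\<in>set xs. dot x y = 0)
        (K * real (slp_size G) powr (2 - \<epsilon>) * real (d + 1) ^ e)"
      using K[OF P(1,2) wf_G _ _ represents_G] by (simp add: occurs_P_iff nonterminals_G P(3))
    from answers_reduction[OF this]
    show ?thesis
      using time_bound[OF assms(1) n_pos d_pos slp_size_G(2) slp_size_le, of K e]
      unfolding answers_def K'_def by (meson order.trans)
  qed
  then show ?thesis
    unfolding solves_OV_def by (intro allI impI exI[of _ K']) auto
qed

theorem theorem1p2:
  assumes "OV_conjecture"
  shows "\<forall>\<epsilon>>0. \<not> (\<exists>e c k. solves_matching \<epsilon> e c k)"
proof (intro allI impI notI)
  fix \<epsilon> :: real
  assume "\<epsilon> > 0" "\<exists>e c k. solves_matching \<epsilon> e c k"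
  then obtain e c k where "solves_OV (min \<epsilon> 1) e c k"
    using solves_OV_of_solves_matching by blast
  moreover have "min \<epsilon> 1 > 0"
    using \<open>\<epsilon> > 0\<close> by simp
  ultimately show False
    using assms unfolding OV_conjecture_def by blast
qed

end
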